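(* Let $\mathcal{E}$ be a cartesian closed category with a homotopy theory $p:1_{\mathcal{E}}\Rightarrow\Pi_0$. Two arrows $f,g:X\to Y$ in $\mathcal{E}$ are $p$-homotopic if there is a connected object $A$ with two global elements $a,b:1\to A$ and an arrow $h:A\times X\to Y$ such that $$h\circ\langle a!,1_X\rangle=f\qquad\text{and}\qquad h\circ\langle b!,1_X\rangle=g,$$ where $a!$ and $b!$ denote the composites $X\xrightarrow{!}1\xrightarrow{a}A$ and $X\xrightarrow{!}1\xrightarrow{b}A$. Furthermore, when $\mathcal{E}$ is a topos satisfying NS and WDQO and $p:1_{\mathcal{E}}\Rightarrow\Pi_0=\mathcal{I}\Pi$ is the induced homotopy theory, the converse holds: if $f,g:X\to Y$ are $p$-homotopic, then there exist such $A$, $a$, $b$ and $h$.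
   Context: A homotopy theory on a cartesian closed category $\mathcal{E}$ is a natural transformation $p:1_{\mathcal{E}}\Rightarrow\Pi_0:\mathcal{E}\to\mathcal{E}$ with $\Pi_0$ preserving finite products and $\mathcal{E}(1,p_X):\mathcal{E}(1,X)\to\mathcal{E}(1,\Pi_0(X))$ surjective for every $X$. The name $\ulcorner f\urcorner:1\to Y^X$ of $f:X\to Y$ is the transpose of $f\circ\pi_X:1\times X\to Y$. Arrows $f,g:X\to Y$ are $p$-homotopic if $p_{Y^X}\circ\ulcorner f\urcorner=p_{Y^X}\circ\ulcorner g\urcorner$. An object $A$ is connected if $\Pi_0(A)=1$ (i.e. is terminal). An object of a topos is decidable if its diagonal is a complemented subobject; $\mathcal{I}:\mathrm{Dec}(\mathcal{E})\to\mathcal{E}$ is the inclusion of the full subcategory of decidable objects. NS: every non-initial object has a point (an arrow from $1$). WDQO: for every object $X$ there is a minimal decidable object, $p_X:X\to\Pi(X)$ with $\Pi(X)$ decidable, such that every arrow $X\to1+1$ factors uniquely through $p_X$. For a topos satisfying NS and WDQO, $\Pi$ is a finite-product-preserving functor left adjoint to $\mathcal{I}$ with unit $p$, and $p:1_{\mathcal{E}}\Rightarrow\mathcal{I}\Pi$ is a homotopy theory (the induced one). *)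

theory Defs
  imports Main
begin

section \<open>Categories\<close>

text \<open>
  A category has a set of objects and a set of arrows, both of arbitrary types; composition is
  written in the usual applicative order and is only constrained on composable arrows.
\<close>

record ('o, 'a) category =
  Obj :: "'o set"
  Arr :: "'a set"
  Src :: "'a \<Rightarrow> 'o"
  Tgt :: "'a \<Rightarrow> 'o"
  Ide :: "'o \<Rightarrow> 'a"
  Comp :: "'a \<Rightarrow> 'a \<Rightarrow> 'a" (infixr "\<cdot>\<index>" 70)

definition hom :: "('o, 'a, 'x) category_scheme \<Rightarrow> 'o \<Rightarrow> 'o \<Rightarrow> 'a set" where
  "hom C X Y = {f \<in> Arr C. Src C f = X \<and> Tgt C f = Y}"

locale category =
  fixes C :: "('o, 'a, 'x) category_scheme" (structure)
  assumes src_obj: "f \<in> Arr C \<Longrightarrow> Src C f \<in> Obj C"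
    and tgt_obj: "f \<in> Arr C \<Longrightarrow> Tgt C f \<in> Obj C"
    and ide_hom: "X \<in> Obj C \<Longrightarrow> Ide C X \<in> hom C X X"
    and comp_hom: "\<lbrakk>f \<in> hom C X Y; g \<in> hom C Y Z\<rbrakk> \<Longrightarrow> g \<cdot> f \<in> hom C X Z"
    and comp_assoc: "\<lbrakk>f \<in> hom C W X; g \<in> hom C X Y; h \<in> hom C Y Z\<rbrakk>
      \<Longrightarrow> (h \<cdot> g) \<cdot> f = h \<cdot> (g \<cdot> f)"
    and comp_ide_right: "f \<in> hom C X Y \<Longrightarrow> f \<cdot> Ide C X = f"
    and comp_ide_left: "f \<in> hom C X Y \<Longrightarrow> Ide C Y \<cdot> f = f"

definition is_mono :: "('o, 'a, 'x) category_scheme \<Rightarrow> 'a \<Rightarrow> bool" where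
  "is_mono C m \<longleftrightarrow> m \<in> Arr C \<and>
     (\<forall>Z\<in>Obj C. \<forall>f\<in>hom C Z (Src C m). \<forall>g\<in>hom C Z (Src C m).
        Comp C m f = Comp C m g \<longrightarrow> f = g)"

definition is_terminal :: "('o, 'a, 'x) category_scheme \<Rightarrow> 'o \<Rightarrow> bool" where
  "is_terminal C T \<longleftrightarrow> T \<in> Obj C \<and> (\<forall>X\<in>Obj C. \<exists>!f. f \<in> hom C X T)"

definition is_initial :: "('o, 'a, 'x) category_scheme \<Rightarrow> 'o \<Rightarrow> bool" where
  "is_initial C I \<longleftrightarrow> I \<in> Obj C \<and> (\<forall>X\<in>Obj C. \<exists>!f. f \<in> hom C I X)"

definition is_product ::
  "('o, 'a, 'x) category_scheme \<Rightarrow> 'o \<Rightarrow> 'o \<Rightarrow> 'o \<Rightarrow> 'a \<Rightarrow> 'a \<Rightarrow> bool" where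
  "is_product C X Y P u v \<longleftrightarrow>
     P \<in> Obj C \<and> u \<in> hom C P X \<and> v \<in> hom C P Y \<and>
     (\<forall>Z\<in>Obj C. \<forall>f\<in>hom C Z X. \<forall>g\<in>hom C Z Y.
        \<exists>!h. h \<in> hom C Z P \<and> Comp C u h = f \<and> Comp C v h = g)"

definition is_coproduct ::
  "('o, 'a, 'x) category_scheme \<Rightarrow> 'o \<Rightarrow> 'o \<Rightarrow> 'o \<Rightarrow> 'a \<Rightarrow> 'a \<Rightarrow> bool" where
  "is_coproduct C X Y S i j \<longleftrightarrow>
     S \<in> Obj C \<and> i \<in> hom C X S \<and> j \<in> hom C Y S \<and>
     (\<forall>Z\<in>Obj C. \<forall>f\<in>hom C X Z. \<forall>g\<in>hom C Y Z.
        \<exists>!h. h \<in> hom C S Z \<and> Comp C h i = f \<and> Comp C h j = g)"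

text \<open>The square is \<open>f \<cdot> u = g \<cdot> v\<close>, with \<open>u\<close> and \<open>v\<close> the projections.\<close>

definition is_pullback ::
  "('o, 'a, 'x) category_scheme \<Rightarrow> 'a \<Rightarrow> 'a \<Rightarrow> 'o \<Rightarrow> 'a \<Rightarrow> 'a \<Rightarrow> bool" where
  "is_pullback C f g P u v \<longleftrightarrow>
     f \<in> Arr C \<and> g \<in> Arr C \<and> Tgt C f = Tgt C g \<and>
     P \<in> Obj C \<and> u \<in> hom C P (Src C f) \<and> v \<in> hom C P (Src C g) \<and>
     Comp C f u = Comp C g v \<and>
     (\<forall>Z\<in>Obj C. \<forall>r\<in>hom C Z (Src C f). \<forall>s\<in>hom C Z (Src C g).
        Comp C f r = Comp C g s \<longrightarrow>
        (\<exists>!h. h \<in> hom C Z P \<and> Comp C u h = r \<and> Comp C v h = s))"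


section \<open>Cartesian closed categories\<close>

text \<open>
  The cartesian closed structure is chosen: \<open>Exp C Y X\<close> is the exponential \<open>Y\<^sup>X\<close>, and
  \<open>Eval C Y X\<close> is the evaluation \<open>Y\<^sup>X \<times> X \<rightarrow> Y\<close>.
\<close>

record ('o, 'a) ccc = "('o, 'a) category" +
  One :: 'o ("\<one>\<index>")
  Prod :: "'o \<Rightarrow> 'o \<Rightarrow> 'o" (infixr "\<otimes>\<index>" 75)
  Fst :: "'o \<Rightarrow> 'o \<Rightarrow> 'a"
  Snd :: "'o \<Rightarrow> 'o \<Rightarrow> 'a"
  Exp :: "'o \<Rightarrow> 'o \<Rightarrow> 'o"
  Eval :: "'o \<Rightarrow> 'o \<Rightarrow> 'a"

definition bang :: "('o, 'a, 'x) ccc_scheme \<Rightarrow> 'o \<Rightarrow> 'a" where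
  "bang C X = (THE f. f \<in> hom C X (One C))"

definition pair :: "('o, 'a, 'x) ccc_scheme \<Rightarrow> 'a \<Rightarrow> 'a \<Rightarrow> 'a" where
  "pair C f g = (THE h. h \<in> hom C (Src C f) (Prod C (Tgt C f) (Tgt C g)) \<and>
     Comp C (Fst C (Tgt C f) (Tgt C g)) h = f \<and>
     Comp C (Snd C (Tgt C f) (Tgt C g)) h = g)"

text \<open>For \<open>k : A \<rightarrow> Y\<^sup>X\<close>, this is the arrow \<open>ev \<cdot> (k \<times> 1\<^sub>X) : A \<times> X \<rightarrow> Y\<close>.\<close>

definition untranspose :: "('o, 'a, 'x) ccc_scheme \<Rightarrow> 'o \<Rightarrow> 'o \<Rightarrow> 'o \<Rightarrow> 'a \<Rightarrow> 'a" where
  "untranspose C A X Y k =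
     Comp C (Eval C Y X) (pair C (Comp C k (Fst C A X)) (Snd C A X))"

locale cartesian_closed = category C
  for C :: "('o, 'a, 'x) ccc_scheme" (structure) +
  assumes one_terminal: "is_terminal C \<one>"
    and prod_product: "\<lbrakk>X \<in> Obj C; Y \<in> Obj C\<rbrakk>
      \<Longrightarrow> is_product C X Y (X \<otimes> Y) (Fst C X Y) (Snd C X Y)"
    and exp_obj: "\<lbrakk>X \<in> Obj C; Y \<in> Obj C\<rbrakk> \<Longrightarrow> Exp C Y X \<in> Obj C"
    and eval_hom: "\<lbrakk>X \<in> Obj C; Y \<in> Obj C\<rbrakk> \<Longrightarrow> Eval C Y X \<in> hom C (Exp C Y X \<otimes> X) Y"
    and exp_universal: "\<lbrakk>A \<in> Obj C; X \<in> Obj C; Y \<in> Obj C; h \<in> hom C (A \<otimes> X) Y\<rbrakk>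
      \<Longrightarrow> \<exists>!k. k \<in> hom C A (Exp C Y X) \<and> untranspose C A X Y k = h"

definition exp_transpose :: "('o, 'a, 'x) ccc_scheme \<Rightarrow> 'o \<Rightarrow> 'o \<Rightarrow> 'o \<Rightarrow> 'a \<Rightarrow> 'a" where
  "exp_transpose C A X Y h = (THE k. k \<in> hom C A (Exp C Y X) \<and> untranspose C A X Y k = h)"

text \<open>The name \<open>1 \<rightarrow> Y\<^sup>X\<close> of an arrow \<open>f : X \<rightarrow> Y\<close>.\<close>

definition name_of :: "('o, 'a, 'x) ccc_scheme \<Rightarrow> 'a \<Rightarrow> 'a" where
  "name_of C f =
     exp_transpose C (One C) (Src C f) (Tgt C f) (Comp C f (Snd C (One C) (Src C f)))"


section \<open>Homotopy theories\<close>

text \<open>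
  An endofunctor \<open>F\<close> is given by its action \<open>Fo\<close> on objects and its action \<open>Fa\<close> on arrows;
  a natural transformation \<open>p\<close> from the identity is given by its components \<open>p X\<close>.
\<close>

definition is_endofunctor ::
  "('o, 'a, 'x) category_scheme \<Rightarrow> ('o \<Rightarrow> 'o) \<Rightarrow> ('a \<Rightarrow> 'a) \<Rightarrow> bool" where
  "is_endofunctor C Fo Fa \<longleftrightarrow>
     (\<forall>X\<in>Obj C. Fo X \<in> Obj C) \<and>
     (\<forall>X\<in>Obj C. \<forall>Y\<in>Obj C. \<forall>f\<in>hom C X Y. Fa f \<in> hom C (Fo X) (Fo Y)) \<and>
     (\<forall>X\<in>Obj C. Fa (Ide C X) = Ide C (Fo X)) \<and>
     (\<forall>X\<in>Obj C. \<forall>Y\<in>Obj C. \<forall>Z\<in>Obj C. \<forall>f\<in>hom C X Y. \<forall>g\<in>hom C Y Z.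
        Fa (Comp C g f) = Comp C (Fa g) (Fa f))"

definition is_natural_from_identity ::
  "('o, 'a, 'x) category_scheme \<Rightarrow> ('o \<Rightarrow> 'o) \<Rightarrow> ('a \<Rightarrow> 'a) \<Rightarrow> ('o \<Rightarrow> 'a) \<Rightarrow> bool" where
  "is_natural_from_identity C Fo Fa p \<longleftrightarrow>
     (\<forall>X\<in>Obj C. p X \<in> hom C X (Fo X)) \<and>
     (\<forall>X\<in>Obj C. \<forall>Y\<in>Obj C. \<forall>f\<in>hom C X Y. Comp C (Fa f) (p X) = Comp C (p Y) f)"

definition preserves_finite_products ::
  "('o, 'a, 'x) category_scheme \<Rightarrow> ('o \<Rightarrow> 'o) \<Rightarrow> ('a \<Rightarrow> 'a) \<Rightarrow> bool" where
  "preserves_finite_products C Fo Fa \<longleftrightarrow>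
     (\<forall>T. is_terminal C T \<longrightarrow> is_terminal C (Fo T)) \<and>
     (\<forall>X\<in>Obj C. \<forall>Y\<in>Obj C. \<forall>P u v.
        is_product C X Y P u v \<longrightarrow> is_product C (Fo X) (Fo Y) (Fo P) (Fa u) (Fa v))"

locale homotopy_theory = cartesian_closed C
  for C :: "('o, 'a, 'x) ccc_scheme" (structure) +
  fixes Po :: "'o \<Rightarrow> 'o" and Pa :: "'a \<Rightarrow> 'a" and p :: "'o \<Rightarrow> 'a"
  assumes endofunctor: "is_endofunctor C Po Pa"
    and natural: "is_natural_from_identity C Po Pa p"
    and products: "preserves_finite_products C Po Pa"
    and surj_on_points: "\<lbrakk>X \<in> Obj C; y \<in> hom C \<one> (Po X)\<rbrakk>
      \<Longrightarrow> \<exists>x \<in> hom C \<one> X. p X \<cdot> x = y"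

definition p_homotopic ::
  "('o, 'a, 'x) ccc_scheme \<Rightarrow> ('o \<Rightarrow> 'a) \<Rightarrow> 'o \<Rightarrow> 'o \<Rightarrow> 'a \<Rightarrow> 'a \<Rightarrow> bool" where
  "p_homotopic C p X Y f g \<longleftrightarrow> f \<in> hom C X Y \<and> g \<in> hom C X Y \<and>
     Comp C (p (Exp C Y X)) (name_of C f) = Comp C (p (Exp C Y X)) (name_of C g)"

definition is_connected :: "('o, 'a, 'x) category_scheme \<Rightarrow> ('o \<Rightarrow> 'o) \<Rightarrow> 'o \<Rightarrow> bool" where
  "is_connected C Po A \<longleftrightarrow> A \<in> Obj C \<and> is_terminal C (Po A)"


section \<open>Toposes and decidable quotients\<close>

definition is_subobject_classifier ::
  "('o, 'a, 'x) ccc_scheme \<Rightarrow> 'o \<Rightarrow> 'a \<Rightarrow> bool" where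
  "is_subobject_classifier C Om tr \<longleftrightarrow> Om \<in> Obj C \<and> tr \<in> hom C (One C) Om \<and>
     (\<forall>m. is_mono C m \<longrightarrow>
        (\<exists>!ch. ch \<in> hom C (Tgt C m) Om \<and>
           is_pullback C ch tr (Src C m) m (bang C (Src C m))))"

text \<open>Finite completeness is given by the terminal object together with pullbacks.\<close>

locale topos = cartesian_closed C
  for C :: "('o, 'a, 'x) ccc_scheme" (structure) +
  assumes has_pullbacks: "\<lbrakk>f \<in> hom C X Z; g \<in> hom C Y Z\<rbrakk> \<Longrightarrow> \<exists>P u v. is_pullback C f g P u v"
    and has_subobject_classifier: "\<exists>Om tr. is_subobject_classifier C Om tr"

definition is_complemented :: "('o, 'a, 'x) category_scheme \<Rightarrow> 'a \<Rightarrow> bool" where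
  "is_complemented C m \<longleftrightarrow> is_mono C m \<and>
     (\<exists>n. is_mono C n \<and> is_coproduct C (Src C m) (Src C n) (Tgt C m) m n)"

definition is_decidable :: "('o, 'a, 'x) ccc_scheme \<Rightarrow> 'o \<Rightarrow> bool" where
  "is_decidable C X \<longleftrightarrow> X \<in> Obj C \<and> is_complemented C (pair C (Ide C X) (Ide C X))"

definition NS :: "('o, 'a, 'x) ccc_scheme \<Rightarrow> bool" where
  "NS C \<longleftrightarrow> (\<forall>X\<in>Obj C. \<not> is_initial C X \<longrightarrow> (\<exists>x. x \<in> hom C (One C) X))"

text \<open>In what follows \<open>two\<close> stands for the object \<open>1 + 1\<close>.\<close>

definition is_minimal_decidable ::
  "('o, 'a, 'x) ccc_scheme \<Rightarrow> 'o \<Rightarrow> 'o \<Rightarrow> 'o \<Rightarrow> 'a \<Rightarrow> bool" where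
  "is_minimal_decidable C two X P q \<longleftrightarrow> is_decidable C P \<and> q \<in> hom C X P \<and>
     (\<forall>f\<in>hom C X two. \<exists>!g. g \<in> hom C P two \<and> Comp C g q = f)"

definition WDQO :: "('o, 'a, 'x) ccc_scheme \<Rightarrow> 'o \<Rightarrow> bool" where
  "WDQO C two \<longleftrightarrow> (\<forall>X\<in>Obj C. \<exists>P q. is_minimal_decidable C two X P q)"

text \<open>
  The data of the homotopy theory induced by WDQO: the components of \<open>p\<close> are the minimal
  decidable objects, and the action on arrows is the one that makes \<open>p\<close> natural.
\<close>

definition is_induced_by_WDQO ::
  "('o, 'a, 'x) ccc_scheme \<Rightarrow> 'o \<Rightarrow> ('o \<Rightarrow> 'o) \<Rightarrow> ('a \<Rightarrow> 'a) \<Rightarrow> ('o \<Rightarrow> 'a) \<Rightarrow> bool" where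
  "is_induced_by_WDQO C two Po Pa p \<longleftrightarrow>
     (\<forall>X\<in>Obj C. is_minimal_decidable C two X (Po X) (p X)) \<and>
     (\<forall>X\<in>Obj C. \<forall>Y\<in>Obj C. \<forall>f\<in>hom C X Y.
        Pa f \<in> hom C (Po X) (Po Y) \<and> Comp C (Pa f) (p X) = Comp C (p Y) f)"

end

theory Submission
  imports Defs
begin

text \<open>
  Transposition identifies the slices \<open>h \<cdot> \<langle>a!, 1\<rangle>\<close> of \<open>h : A \<times> X \<rightarrow> Y\<close> with the points \<open>k \<cdot> a\<close> of
  \<open>Y\<^sup>X\<close>, where \<open>k\<close> is the transpose of \<open>h\<close>; naturality of \<open>p\<close> at \<open>k\<close> and \<open>\<Pi>\<^sub>0(A) = 1\<close> give the first half.
  For the converse, \<open>A\<close> is the fibre of \<open>p : Z \<rightarrow> \<Pi>(Z)\<close> over the common image of the two names,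
  where \<open>Z = Y\<^sup>X\<close>. Since \<open>two \<times> T\<close> is the coproduct \<open>T + T\<close>, arrows can be defined by cases on an arrow
  into \<open>two\<close>. Membership in \<open>A\<close> is decided by an arrow \<open>Z \<rightarrow> two\<close>, and \<open>A\<close> has a point, hence \<open>A\<close> is
  a retract of \<open>Z\<close>. So every arrow \<open>A \<rightarrow> two\<close> extends to \<open>Z\<close>, factors through \<open>\<Pi>(Z)\<close> and is constant,
  which forces \<open>\<Pi>(A) = 1\<close>.
\<close>

section \<open>Typed arrows, terminal objects and coproducts\<close>

lemma hom_src: "f \<in> hom C X Y \<Longrightarrow> Src C f = X"
  and hom_tgt: "f \<in> hom C X Y \<Longrightarrow> Tgt C f = Y"
  by (simp_all add: hom_def)

context category
begin

lemma hom_src_obj: "f \<in> hom C X Y \<Longrightarrow> X \<in> Obj C"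
  and hom_tgt_obj: "f \<in> hom C X Y \<Longrightarrow> Y \<in> Obj C"
  using src_obj tgt_obj by (auto simp: hom_def)

end

lemma terminal_unique:
  assumes "is_terminal C T" "X \<in> Obj C" "f \<in> hom C X T" "g \<in> hom C X T"
  shows "f = g"
  using assms unfolding is_terminal_def by blast

text \<open>No category axioms are available here, so the typing of the two composites has to be
  assumed.\<close>

lemma coproduct_ext:
  assumes "is_coproduct C X Y S i j" "Z \<in> Obj C" "h \<in> hom C S Z" "h' \<in> hom C S Z"
    and "Comp C h i \<in> hom C X Z" "Comp C h j \<in> hom C Y Z"
    and "Comp C h i = Comp C h' i" "Comp C h j = Comp C h' j"
  shows "h = h'"
  using assms unfolding is_coproduct_def by metis

section \<open>Constant arrows, pairing and slices\<close>

context cartesian_closed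
begin

lemma one_obj: "\<one> \<in> Obj C"
  using one_terminal by (simp add: is_terminal_def)

lemma bang_hom: "X \<in> Obj C \<Longrightarrow> bang C X \<in> hom C X \<one>"
  unfolding bang_def using one_terminal theI'[of "\<lambda>f. f \<in> hom C X \<one>"] by (simp add: is_terminal_def)

lemma to_one: "f \<in> hom C X \<one> \<Longrightarrow> f = bang C X"
  by (rule terminal_unique[OF one_terminal hom_src_obj _ bang_hom[OF hom_src_obj]])

lemma bang_comp: "f \<in> hom C X Y \<Longrightarrow> bang C Y \<cdot> f = bang C X"
  by (rule to_one[OF comp_hom[OF _ bang_hom[OF hom_tgt_obj]]])

lemma point_bang_comp:
  assumes "a \<in> hom C \<one> Y" "f \<in> hom C T X"
  shows "(a \<cdot> bang C X) \<cdot> f = a \<cdot> bang C T"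
  using comp_assoc[OF assms(2) bang_hom[OF hom_tgt_obj[OF assms(2)]] assms(1)]
    bang_comp[OF assms(2)] by simp

lemma point_bang_one: "a \<in> hom C \<one> Y \<Longrightarrow> a \<cdot> bang C \<one> = a"
  using to_one[OF ide_hom[OF one_obj]] comp_ide_right[of a \<one> Y] by simp

lemma prod_obj: "\<lbrakk>X \<in> Obj C; Y \<in> Obj C\<rbrakk> \<Longrightarrow> X \<otimes> Y \<in> Obj C"
  and fst_hom: "\<lbrakk>X \<in> Obj C; Y \<in> Obj C\<rbrakk> \<Longrightarrow> Fst C X Y \<in> hom C (X \<otimes> Y) X"
  and snd_hom: "\<lbrakk>X \<in> Obj C; Y \<in> Obj C\<rbrakk> \<Longrightarrow> Snd C X Y \<in> hom C (X \<otimes> Y) Y"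
  using prod_product[of X Y] by (simp_all add: is_product_def)

lemma pair_unique_existence:
  assumes "f \<in> hom C Z X" "g \<in> hom C Z Y"
  shows "\<exists>!h. h \<in> hom C Z (X \<otimes> Y) \<and> Fst C X Y \<cdot> h = f \<and> Snd C X Y \<cdot> h = g"
  using prod_product[OF hom_tgt_obj[OF assms(1)] hom_tgt_obj[OF assms(2)]]
    hom_src_obj[OF assms(1)] assms by (simp add: is_product_def)

lemma pair_hom: "\<lbrakk>f \<in> hom C Z X; g \<in> hom C Z Y\<rbrakk> \<Longrightarrow> pair C f g \<in> hom C Z (X \<otimes> Y)"
  and fst_pair: "\<lbrakk>f \<in> hom C Z X; g \<in> hom C Z Y\<rbrakk> \<Longrightarrow> Fst C X Y \<cdot> pair C f g = f"
  and snd_pair: "\<lbrakk>f \<in> hom C Z X; g \<in> hom C Z Y\<rbrakk> \<Longrightarrow> Snd C X Y \<cdot> pair C f g = g"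
  using theI'[OF pair_unique_existence[of f Z X g Y]] by (simp_all add: pair_def hom_src hom_tgt)

lemma pair_eqI:
  assumes "f \<in> hom C Z X" "g \<in> hom C Z Y" "h \<in> hom C Z (X \<otimes> Y)"
    and "Fst C X Y \<cdot> h = f" "Snd C X Y \<cdot> h = g"
  shows "h = pair C f g"
  using pair_unique_existence[OF assms(1,2)] assms(3-5) pair_hom[OF assms(1,2)]
    fst_pair[OF assms(1,2)] snd_pair[OF assms(1,2)] by blast

lemma pair_comp:
  assumes "f \<in> hom C Z X" "g \<in> hom C Z Y" "t \<in> hom C T Z"
  shows "pair C f g \<cdot> t = pair C (f \<cdot> t) (g \<cdot> t)"
proof (rule pair_eqI)
  have XY: "X \<in> Obj C" "Y \<in> Obj C"
    using assms hom_tgt_obj by blast+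
  note h = pair_hom[OF assms(1,2)]
  show "f \<cdot> t \<in> hom C T X" "g \<cdot> t \<in> hom C T Y" "pair C f g \<cdot> t \<in> hom C T (X \<otimes> Y)"
    using assms h comp_hom by blast+
  show "Fst C X Y \<cdot> (pair C f g \<cdot> t) = f \<cdot> t"
    using comp_assoc[OF assms(3) h fst_hom[OF XY]] assms by (simp add: fst_pair)
  show "Snd C X Y \<cdot> (pair C f g \<cdot> t) = g \<cdot> t"
    using comp_assoc[OF assms(3) h snd_hom[OF XY]] assms by (simp add: snd_pair)
qed

text \<open>An instance of \<open>pair_comp\<close>: the constant coordinate absorbs
  \<open>t\<close> and the identity coordinate returns it.\<close>

lemma point_slice:
  assumes "a \<in> hom C \<one> A" "t \<in> hom C T X"
  shows "pair C (a \<cdot> bang C X) (Ide C X) \<cdot> t = pair C (a \<cdot> bang C T) t"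
proof -
  have X: "X \<in> Obj C"
    using assms(2) by (rule hom_tgt_obj)
  show ?thesis
    using pair_comp[OF comp_hom[OF bang_hom[OF X] assms(1)] ide_hom[OF X] assms(2)]
      point_bang_comp[OF assms] comp_ide_left[OF assms(2)] by simp
qed

lemma slice_hom:
  assumes "a \<in> hom C \<one> A" "X \<in> Obj C"
  shows "pair C (a \<cdot> bang C X) (Ide C X) \<in> hom C X (A \<otimes> X)"
  by (rule pair_hom[OF comp_hom[OF bang_hom[OF assms(2)] assms(1)] ide_hom[OF assms(2)]])

section \<open>Transposes, names and evaluation\<close>

lemma untranspose_hom:
  assumes "k \<in> hom C A (Exp C Y X)" "X \<in> Obj C" "Y \<in> Obj C"
  shows "untranspose C A X Y k \<in> hom C (A \<otimes> X) Y"
proof -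
  note A = hom_src_obj[OF assms(1)]
  show ?thesis
    unfolding untranspose_def
    by (rule comp_hom[OF pair_hom[OF comp_hom[OF fst_hom[OF A assms(2)] assms(1)]
            snd_hom[OF A assms(2)]] eval_hom[OF assms(2,3)]])
qed

lemma untranspose_pair:
  assumes k: "k \<in> hom C A (Exp C Y X)" and X: "X \<in> Obj C" and Y: "Y \<in> Obj C"
    and t: "t \<in> hom C T A" and x: "x \<in> hom C T X"
  shows "untranspose C A X Y k \<cdot> pair C t x = Eval C Y X \<cdot> pair C (k \<cdot> t) x"
proof -
  have A: "A \<in> Obj C"
    using k hom_src_obj by blast
  note tx = pair_hom[OF t x] and F = fst_hom[OF A X] and S = snd_hom[OF A X]
  have "pair C (k \<cdot> Fst C A X) (Snd C A X) \<cdot> pair C t x = pair C (k \<cdot> t) x"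
    using pair_comp[OF comp_hom[OF F k] S tx] comp_assoc[OF tx F k] fst_pair[OF t x]
      snd_pair[OF t x] by simp
  then show ?thesis
    unfolding untranspose_def
    using comp_assoc[OF tx pair_hom[OF comp_hom[OF F k] S] eval_hom[OF X Y]] by simp
qed

lemma name_of_hom_untranspose:
  assumes f: "f \<in> hom C X Y"
  shows "name_of C f \<in> hom C \<one> (Exp C Y X) \<and>
    untranspose C \<one> X Y (name_of C f) = f \<cdot> Snd C \<one> X"
proof -
  have XY: "X \<in> Obj C" "Y \<in> Obj C"
    using f hom_src_obj hom_tgt_obj by blast+
  have "f \<cdot> Snd C \<one> X \<in> hom C (\<one> \<otimes> X) Y"
    using f XY comp_hom snd_hom one_obj by blast
  from theI'[OF exp_universal[OF one_obj XY this]] show ?thesis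
    by (simp add: name_of_def exp_transpose_def hom_src[OF f] hom_tgt[OF f])
qed

lemma name_of_hom: "f \<in> hom C X Y \<Longrightarrow> name_of C f \<in> hom C \<one> (Exp C Y X)"
  using name_of_hom_untranspose by blast

text \<open>The name is defined through \<open>\<one> \<otimes> X\<close>, while slices live on
  \<open>X\<close>. Composition with the projection from \<open>\<one> \<otimes> X\<close> to
  \<open>X\<close> and with its section \<open>\<langle>!, 1\<rangle>\<close> passes between the
  two, and uniqueness of transposes then identifies \<open>n\<close>.\<close>

lemma eval_point_iff_name_of:
  assumes f: "f \<in> hom C X Y" and n: "n \<in> hom C \<one> (Exp C Y X)"
  shows "Eval C Y X \<cdot> pair C (n \<cdot> bang C X) (Ide C X) = f \<longleftrightarrow> n = name_of C f"
proof
  have X: "X \<in> Obj C" and Y: "Y \<in> Obj C"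
    using f hom_src_obj hom_tgt_obj by blast+
  note S = snd_hom[OF one_obj X] and F = fst_hom[OF one_obj X] and E = eval_hom[OF X Y]
    and B = bang_hom[OF X] and I = ide_hom[OF X]
  {
    assume "Eval C Y X \<cdot> pair C (n \<cdot> bang C X) (Ide C X) = f"
    then have "f \<cdot> Snd C \<one> X = Eval C Y X \<cdot> (pair C (n \<cdot> bang C X) (Ide C X) \<cdot> Snd C \<one> X)"
      using comp_assoc[OF S slice_hom[OF n X] E] by simp
    \<comment> \<open>The projection \<open>Fst C \<one> X\<close> ends in the terminal object, so
      it is the arrow \<open>bang\<close>; this brings the constant coordinate into the form found
      in \<open>untranspose\<close>.\<close>
    also have "pair C (n \<cdot> bang C X) (Ide C X) \<cdot> Snd C \<one> X
        = pair C (n \<cdot> Fst C \<one> X) (Snd C \<one> X)"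
      using point_slice[OF n S] to_one[OF F] by simp
    finally have "untranspose C \<one> X Y n = f \<cdot> Snd C \<one> X"
      by (simp add: untranspose_def)
    then show "n = name_of C f"
      using exp_universal[OF one_obj X Y comp_hom[OF S f]] name_of_hom_untranspose[OF f] n
      by blast
  next
    assume "n = name_of C f"
    then have "untranspose C \<one> X Y n \<cdot> pair C (bang C X) (Ide C X)
        = (f \<cdot> Snd C \<one> X) \<cdot> pair C (bang C X) (Ide C X)"
      using name_of_hom_untranspose[OF f] by simp
    also have "\<dots> = f"
      using comp_assoc[OF pair_hom[OF B I] S f] snd_pair[OF B I] comp_ide_right[OF f] by simp
    finally show "Eval C Y X \<cdot> pair C (n \<cdot> bang C X) (Ide C X) = f"
      using untranspose_pair[OF n X Y B I] by simp
  }
qed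

text \<open>The slice at \<open>a\<close> evaluates the family \<open>k\<close> at the single point
  \<open>k \<cdot> a\<close>, so the criterion for points applies.\<close>

lemma untranspose_slice_iff:
  assumes k: "k \<in> hom C A (Exp C Y X)" and a: "a \<in> hom C \<one> A" and f: "f \<in> hom C X Y"
  shows "untranspose C A X Y k \<cdot> pair C (a \<cdot> bang C X) (Ide C X) = f
    \<longleftrightarrow> k \<cdot> a = name_of C f"
proof -
  have X: "X \<in> Obj C" and Y: "Y \<in> Obj C"
    using f hom_src_obj hom_tgt_obj by blast+
  note B = bang_hom[OF X]
  show ?thesis
    using untranspose_pair[OF k X Y comp_hom[OF B a] ide_hom[OF X]] comp_assoc[OF B a k]
      eval_point_iff_name_of[OF f comp_hom[OF a k]] by simp
qed

text \<open>One transpose \<open>k\<close> serves all points \<open>a\<close> and all arrows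
  \<open>f\<close>, so both ends of a homotopy can be read off the same \<open>k\<close>.\<close>

lemma slice_eq_iff_transpose:
  assumes h: "h \<in> hom C (A \<otimes> X) Y" and AX: "A \<in> Obj C" "X \<in> Obj C"
  obtains k where "k \<in> hom C A (Exp C Y X)" "h = untranspose C A X Y k"
    "\<And>a f. \<lbrakk>a \<in> hom C \<one> A; f \<in> hom C X Y\<rbrakk> \<Longrightarrow>
       h \<cdot> pair C (a \<cdot> bang C X) (Ide C X) = f \<longleftrightarrow> k \<cdot> a = name_of C f"
  using exp_universal[OF AX hom_tgt_obj[OF h] h] untranspose_slice_iff by metis

end

section \<open>The object \<open>1 + 1\<close>, with \<open>i\<close> read as true and
  \<open>j\<close> as false, and definition by cases\<close>

locale cartesian_closed_two = cartesian_closed C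
  for C :: "('o, 'a, 'x) ccc_scheme" (structure) +
  fixes two :: 'o and i j :: 'a
  assumes two_coproduct: "is_coproduct C \<one> \<one> two i j"
begin

lemma two_obj: "two \<in> Obj C" and i_hom: "i \<in> hom C \<one> two" and j_hom: "j \<in> hom C \<one> two"
  using two_coproduct by (simp_all add: is_coproduct_def)

text \<open>Existence half of \<open>two \<otimes> X = X + X\<close>: the product with
  \<open>X\<close> has a right adjoint, so it preserves the coproduct. Concretely, the copairing of
  the names of \<open>f\<close> and \<open>g\<close> is transposed back.\<close>

lemma case_arrow:
  assumes f: "f \<in> hom C X Y" and g: "g \<in> hom C X Y"
  obtains c where "c \<in> hom C (two \<otimes> X) Y"
    "c \<cdot> pair C (i \<cdot> bang C X) (Ide C X) = f" "c \<cdot> pair C (j \<cdot> bang C X) (Ide C X) = g"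
proof -
  have X: "X \<in> Obj C" and Y: "Y \<in> Obj C"
    using f hom_src_obj hom_tgt_obj by blast+
  obtain k where k: "k \<in> hom C two (Exp C Y X)" "k \<cdot> i = name_of C f" "k \<cdot> j = name_of C g"
    using two_coproduct name_of_hom[OF f] name_of_hom[OF g] exp_obj[OF X Y]
    unfolding is_coproduct_def by metis
  show ?thesis
    using that[OF untranspose_hom[OF k(1) X Y]] untranspose_slice_iff[OF k(1) i_hom f]
      untranspose_slice_iff[OF k(1) j_hom g] k by simp
qed

text \<open>Uniqueness half: the transposes are arrows out of \<open>two\<close>, hence determined
  by their values at \<open>i\<close> and \<open>j\<close>.\<close>

lemma case_ext:
  assumes c: "c \<in> hom C (two \<otimes> X) Y" and c': "c' \<in> hom C (two \<otimes> X) Y" and X: "X \<in> Obj C"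
    and i: "c \<cdot> pair C (i \<cdot> bang C X) (Ide C X) = c' \<cdot> pair C (i \<cdot> bang C X) (Ide C X)"
    and j: "c \<cdot> pair C (j \<cdot> bang C X) (Ide C X) = c' \<cdot> pair C (j \<cdot> bang C X) (Ide C X)"
  shows "c = c'"
proof -
  have Y: "Y \<in> Obj C"
    using c hom_tgt_obj by blast
  obtain k where k: "k \<in> hom C two (Exp C Y X)" "c = untranspose C two X Y k"
    "\<And>a f. \<lbrakk>a \<in> hom C \<one> two; f \<in> hom C X Y\<rbrakk> \<Longrightarrow>
       c \<cdot> pair C (a \<cdot> bang C X) (Ide C X) = f \<longleftrightarrow> k \<cdot> a = name_of C f"
    using slice_eq_iff_transpose[OF c two_obj X] by metis
  obtain k' where k': "k' \<in> hom C two (Exp C Y X)" "c' = untranspose C two X Y k'"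
    "\<And>a f. \<lbrakk>a \<in> hom C \<one> two; f \<in> hom C X Y\<rbrakk> \<Longrightarrow>
       c' \<cdot> pair C (a \<cdot> bang C X) (Ide C X) = f \<longleftrightarrow> k' \<cdot> a = name_of C f"
    using slice_eq_iff_transpose[OF c' two_obj X] by metis
  \<comment> \<open>The slices of \<open>c'\<close> serve as common reference arrows: the matching
    values of \<open>k\<close> and \<open>k'\<close> are both their names.\<close>
  note si = comp_hom[OF slice_hom[OF i_hom X] c'] and sj = comp_hom[OF slice_hom[OF j_hom X] c']
  have "k = k'"
  proof (rule coproduct_ext[OF two_coproduct exp_obj[OF X Y] k(1) k'(1)])
    show "k \<cdot> i \<in> hom C \<one> (Exp C Y X)" "k \<cdot> j \<in> hom C \<one> (Exp C Y X)"
      using comp_hom i_hom j_hom k(1) by blast+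
    show "k \<cdot> i = k' \<cdot> i"
      using k(3)[OF i_hom si] k'(3)[OF i_hom si] i by simp
    show "k \<cdot> j = k' \<cdot> j"
      using k(3)[OF j_hom sj] k'(3)[OF j_hom sj] j by simp
  qed
  then show ?thesis
    using k(2) k'(2) by simp
qed

text \<open>Resolves a case distinction at a generalized element whose deciding coordinate is
  already the constant \<open>a\<close>.\<close>

lemma case_comp:
  assumes c: "c \<in> hom C (two \<otimes> X) Y" and a: "a \<in> hom C \<one> two" and t: "t \<in> hom C T X"
    and f: "c \<cdot> pair C (a \<cdot> bang C X) (Ide C X) = f"
  shows "c \<cdot> pair C (a \<cdot> bang C T) t = f \<cdot> t"
  using comp_assoc[OF t slice_hom[OF a hom_tgt_obj[OF t]] c] point_slice[OF a t] f by simp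

text \<open>The arrow \<open>e\<close> is true on the diagonal and false on its complement. That a
  true test forces equality is shown without appeal to disjointness of \<open>i\<close> and
  \<open>j\<close>: selecting between the two projections by \<open>e\<close> yields
  \<open>Snd\<close> throughout, so wherever \<open>e\<close> is true the projections agree.\<close>

lemma decidable_equality_test:
  assumes "is_decidable C P"
  obtains e where "e \<in> hom C (P \<otimes> P) two"
    "\<And>T r s. \<lbrakk>r \<in> hom C T P; s \<in> hom C T P\<rbrakk> \<Longrightarrow> e \<cdot> pair C r s = i \<cdot> bang C T \<longleftrightarrow> r = s"
proof -
  have P: "P \<in> Obj C"
    using assms by (simp add: is_decidable_def)
  let ?D = "pair C (Ide C P) (Ide C P)" and ?F = "Fst C P P" and ?S = "Snd C P P"
  note I = ide_hom[OF P] and F = fst_hom[OF P P] and S = snd_hom[OF P P]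
    and PP = prod_obj[OF P P]
  note D = pair_hom[OF I I]
  obtain n where "is_coproduct C (Src C ?D) (Src C n) (Tgt C ?D) ?D n"
    using assms unfolding is_decidable_def is_complemented_def by blast
  then obtain N where cop: "is_coproduct C P N (P \<otimes> P) ?D n"
    by (auto simp: hom_src[OF D] hom_tgt[OF D])
  then have n: "n \<in> hom C N (P \<otimes> P)"
    by (simp add: is_coproduct_def)
  note bi = comp_hom[OF bang_hom[OF P] i_hom]
    and bj = comp_hom[OF bang_hom[OF hom_src_obj[OF n]] j_hom]
  obtain e where e: "e \<in> hom C (P \<otimes> P) two" "e \<cdot> ?D = i \<cdot> bang C P" "e \<cdot> n = j \<cdot> bang C N"
    using cop bi bj two_obj unfolding is_coproduct_def by metis
  obtain c where c: "c \<in> hom C (two \<otimes> (P \<otimes> P)) P"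
    and ci: "c \<cdot> pair C (i \<cdot> bang C (P \<otimes> P)) (Ide C (P \<otimes> P)) = ?F"
    and cj: "c \<cdot> pair C (j \<cdot> bang C (P \<otimes> P)) (Ide C (P \<otimes> P)) = ?S"
    using case_arrow[OF F S] .
  let ?v = "c \<cdot> pair C e (Ide C (P \<otimes> P))"
  note ePP = pair_hom[OF e(1) ide_hom[OF PP]]
  have v_comp: "?v \<cdot> t = c \<cdot> pair C (e \<cdot> t) t" if t: "t \<in> hom C T (P \<otimes> P)" for t T
    using comp_assoc[OF t ePP c] pair_comp[OF e(1) ide_hom[OF PP] t] comp_ide_left[OF t] by simp
  \<comment> \<open>Selecting the first component on the diagonal and the second one off it always gives the second.\<close>
  have v_eq: "?v = ?S"
  proof (rule coproduct_ext[OF cop P comp_hom[OF ePP c] S])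
    show "?v \<cdot> ?D \<in> hom C P P" "?v \<cdot> n \<in> hom C N P"
      using comp_hom[OF D comp_hom[OF ePP c]] comp_hom[OF n comp_hom[OF ePP c]] .
    show "?v \<cdot> ?D = ?S \<cdot> ?D"
      using v_comp[OF D] e(2) case_comp[OF c i_hom D ci] fst_pair[OF I I] snd_pair[OF I I] by simp
    show "?v \<cdot> n = ?S \<cdot> n"
      using v_comp[OF n] e(3) case_comp[OF c j_hom n cj] by simp
  qed
  have "e \<cdot> pair C r s = i \<cdot> bang C T \<longleftrightarrow> r = s"
    if r: "r \<in> hom C T P" and s: "s \<in> hom C T P" for T r s
  proof
    note rs = pair_hom[OF r s]
    assume "e \<cdot> pair C r s = i \<cdot> bang C T"
    then have "?S \<cdot> pair C r s = ?F \<cdot> pair C r s"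
      using v_comp[OF rs] v_eq case_comp[OF c i_hom rs ci] by simp
    then show "r = s"
      using fst_pair[OF r s] snd_pair[OF r s] by simp
  next
    assume "r = s"
    then have "pair C r s = ?D \<cdot> r"
      using pair_comp[OF I I r] comp_ide_left[OF r] by simp
    then show "e \<cdot> pair C r s = i \<cdot> bang C T"
      using comp_assoc[OF r D e(1)] e(2) point_bang_comp[OF i_hom r] by simp
  qed
  then show ?thesis
    using that e(1) by blast
qed

text \<open>Off the subobject, the retraction takes the value \<open>x\<close>.\<close>

lemma pointed_preimage_retract:
  assumes w: "w \<in> hom C Z two" and x: "x \<in> hom C \<one> Z" and wx: "w \<cdot> x = i"
  obtains r where "r \<in> hom C Z Z" "w \<cdot> r = i \<cdot> bang C Z"
    "\<And>T t. \<lbrakk>t \<in> hom C T Z; w \<cdot> t = i \<cdot> bang C T\<rbrakk> \<Longrightarrow> r \<cdot> t = t"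
proof -
  have Z: "Z \<in> Obj C"
    using w hom_src_obj by blast
  note I = ide_hom[OF Z] and I2 = ide_hom[OF two_obj]
  obtain c where c: "c \<in> hom C (two \<otimes> Z) Z"
    and ci: "c \<cdot> pair C (i \<cdot> bang C Z) (Ide C Z) = Ide C Z"
    and cj: "c \<cdot> pair C (j \<cdot> bang C Z) (Ide C Z) = x \<cdot> bang C Z"
    using case_arrow[OF I comp_hom[OF bang_hom[OF Z] x]] .
  \<comment> \<open>On truth values \<open>d\<close> is implication: \<open>d(i, v) = v\<close> and
    \<open>d(j, v) = i\<close>.\<close>
  obtain d where d: "d \<in> hom C (two \<otimes> two) two"
    and di: "d \<cdot> pair C (i \<cdot> bang C two) (Ide C two) = Ide C two"
    and dj: "d \<cdot> pair C (j \<cdot> bang C two) (Ide C two) = i \<cdot> bang C two"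
    using case_arrow[OF I2 comp_hom[OF bang_hom[OF two_obj] i_hom]] .
  note F = fst_hom[OF two_obj Z] and S = snd_hom[OF two_obj Z]
  let ?W = "pair C (Fst C two Z) (w \<cdot> Snd C two Z)"
  note W = pair_hom[OF F comp_hom[OF S w]]
  have W_pair: "?W \<cdot> pair C u t = pair C u (w \<cdot> t)"
    if u: "u \<in> hom C T two" and t: "t \<in> hom C T Z" for u t T
    using pair_comp[OF F comp_hom[OF S w] pair_hom[OF u t]] comp_assoc[OF pair_hom[OF u t] S w]
      fst_pair[OF u t] snd_pair[OF u t] by simp
  note bi = comp_hom[OF bang_hom[OF Z] i_hom] and bj = comp_hom[OF bang_hom[OF Z] j_hom]
  \<comment> \<open>Here \<open>?W\<close> is the product arrow \<open>1 \<times> w\<close>. In the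
    case \<open>i\<close> the selection \<open>c\<close> returns its argument; in the case
    \<open>j\<close> it returns \<open>x\<close>, where \<open>w\<close> is true. So
    \<open>w\<close> turns the selection \<open>c\<close> into the implication
    \<open>d\<close>.\<close>
  have wc: "w \<cdot> c = d \<cdot> ?W"
  proof (rule case_ext[OF comp_hom[OF c w] comp_hom[OF W d] Z])
    show "(w \<cdot> c) \<cdot> pair C (i \<cdot> bang C Z) (Ide C Z) = (d \<cdot> ?W) \<cdot> pair C (i \<cdot> bang C Z) (Ide C Z)"
      using comp_assoc[OF pair_hom[OF bi I] c w] comp_assoc[OF pair_hom[OF bi I] W d]
        W_pair[OF bi I] case_comp[OF d i_hom w di] ci comp_ide_right[OF w] comp_ide_left[OF w]
      by simp
    show "(w \<cdot> c) \<cdot> pair C (j \<cdot> bang C Z) (Ide C Z) = (d \<cdot> ?W) \<cdot> pair C (j \<cdot> bang C Z) (Ide C Z)"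
      using comp_assoc[OF pair_hom[OF bj I] c w] comp_assoc[OF pair_hom[OF bj I] W d]
        W_pair[OF bj I] case_comp[OF d j_hom w dj] cj comp_ide_right[OF w]
        comp_assoc[OF bang_hom[OF Z] x w] wx point_bang_comp[OF i_hom w]
      by simp
  qed
  \<comment> \<open>Every truth value implies itself; it suffices to check this at \<open>i\<close>
    and \<open>j\<close>.\<close>
  have dd: "d \<cdot> pair C (Ide C two) (Ide C two) = i \<cdot> bang C two"
  proof (rule coproduct_ext[OF two_coproduct two_obj comp_hom[OF pair_hom[OF I2 I2] d]
          comp_hom[OF bang_hom[OF two_obj] i_hom]])
    show "(d \<cdot> pair C (Ide C two) (Ide C two)) \<cdot> i \<in> hom C \<one> two"
      "(d \<cdot> pair C (Ide C two) (Ide C two)) \<cdot> j \<in> hom C \<one> two"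
      using comp_hom[OF _ comp_hom[OF pair_hom[OF I2 I2] d]] i_hom j_hom by blast+
    show "(d \<cdot> pair C (Ide C two) (Ide C two)) \<cdot> i = (i \<cdot> bang C two) \<cdot> i"
      using comp_assoc[OF i_hom pair_hom[OF I2 I2] d] pair_comp[OF I2 I2 i_hom]
        comp_ide_left[OF i_hom] case_comp[OF d i_hom i_hom di] point_bang_one[OF i_hom]
        point_bang_comp[OF i_hom i_hom] by simp
    show "(d \<cdot> pair C (Ide C two) (Ide C two)) \<cdot> j = (i \<cdot> bang C two) \<cdot> j"
      using comp_assoc[OF j_hom pair_hom[OF I2 I2] d] pair_comp[OF I2 I2 j_hom]
        comp_ide_left[OF j_hom] case_comp[OF d j_hom j_hom dj] point_bang_one[OF j_hom]
      by simp
  qed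
  let ?r = "c \<cdot> pair C w (Ide C Z)"
  note wI = pair_hom[OF w I]
  \<comment> \<open>The retraction lets \<open>w\<close> itself decide the case, so applying
    \<open>w\<close> to it gives the implication from \<open>w\<close> to \<open>w\<close>.\<close>
  have "w \<cdot> ?r = d \<cdot> pair C w w"
    using comp_assoc[OF wI c w] comp_assoc[OF wI W d] wc W_pair[OF w I] comp_ide_right[OF w]
    by simp
  also have "\<dots> = (d \<cdot> pair C (Ide C two) (Ide C two)) \<cdot> w"
    using comp_assoc[OF w pair_hom[OF I2 I2] d] pair_comp[OF I2 I2 w] comp_ide_left[OF w] by simp
  also have "\<dots> = i \<cdot> bang C Z"
    using dd point_bang_comp[OF i_hom w] by simp
  finally have "w \<cdot> ?r = i \<cdot> bang C Z" .
  moreover have "?r \<cdot> t = t" if t: "t \<in> hom C T Z" "w \<cdot> t = i \<cdot> bang C T" for T t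
    using comp_assoc[OF t(1) wI c] pair_comp[OF w I t(1)] comp_ide_left[OF t(1)]
      case_comp[OF c i_hom t(1) ci] t(2) by simp
  ultimately show ?thesis
    using that comp_hom[OF wI c] by blast
qed

section \<open>Minimal decidable objects of fibres\<close>

text \<open>The test for equality with the point \<open>q \<cdot> x\<close> is constantly true after
  composition with \<open>q\<close>. Factorizations through \<open>q\<close> of arrows into
  \<open>two\<close> are unique, so the test is already true on \<open>P\<close>, and the identity
  of \<open>P\<close> is constant.\<close>

lemma minimal_decidable_terminal:
  assumes min: "is_minimal_decidable C two A P q" and x: "x \<in> hom C \<one> A"
    and const: "\<And>u. u \<in> hom C A two \<Longrightarrow> u = (u \<cdot> x) \<cdot> bang C A"
  shows "is_terminal C P"
proof -
  have dec: "is_decidable C P" and q: "q \<in> hom C A P"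
    using min by (simp_all add: is_minimal_decidable_def)
  have P: "P \<in> Obj C" and A: "A \<in> Obj C"
    using q hom_src_obj hom_tgt_obj by blast+
  obtain e where e: "e \<in> hom C (P \<otimes> P) two"
    and e_iff: "\<And>T r s. \<lbrakk>r \<in> hom C T P; s \<in> hom C T P\<rbrakk> \<Longrightarrow>
      e \<cdot> pair C r s = i \<cdot> bang C T \<longleftrightarrow> r = s"
    using decidable_equality_test[OF dec] by metis
  note I = ide_hom[OF P] and qx = comp_hom[OF x q]
  let ?c = "(q \<cdot> x) \<cdot> bang C P"
  note c = comp_hom[OF bang_hom[OF P] qx] and cA = comp_hom[OF bang_hom[OF A] qx]
  let ?u = "e \<cdot> pair C q ((q \<cdot> x) \<cdot> bang C A)"
  note u = comp_hom[OF pair_hom[OF q cA] e]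
  \<comment> \<open>By \<open>const\<close> the test \<open>?u\<close> is fixed by its value at
    \<open>x\<close>, where \<open>q \<cdot> x\<close> is compared with itself.\<close>
  have "?u \<cdot> x = i \<cdot> bang C \<one>"
    using comp_assoc[OF x pair_hom[OF q cA] e] pair_comp[OF q cA x] point_bang_comp[OF qx x]
      point_bang_one[OF qx] e_iff[OF qx qx] by simp
  then have "?u = i \<cdot> bang C A"
    using const[OF u] point_bang_one[OF i_hom] by simp
  then have "(e \<cdot> pair C (Ide C P) ?c) \<cdot> q = (i \<cdot> bang C P) \<cdot> q"
    using comp_assoc[OF q pair_hom[OF I c] e] pair_comp[OF I c q] comp_ide_left[OF q]
      point_bang_comp[OF qx q] point_bang_comp[OF i_hom q] by simp
  moreover have "e \<cdot> pair C (Ide C P) ?c \<in> hom C P two" "i \<cdot> bang C P \<in> hom C P two"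
    using comp_hom[OF pair_hom[OF I c] e] comp_hom[OF bang_hom[OF P] i_hom] .
  ultimately have "e \<cdot> pair C (Ide C P) ?c = i \<cdot> bang C P"
    using min comp_hom[OF q] unfolding is_minimal_decidable_def by metis
  then have c_ide: "Ide C P = ?c"
    using e_iff[OF I c] by simp
  have "f = (q \<cdot> x) \<cdot> bang C T" if f: "f \<in> hom C T P" for f T
    using comp_ide_left[OF f] c_ide point_bang_comp[OF qx f] by simp
  then show ?thesis
    unfolding is_terminal_def using P comp_hom[OF bang_hom qx] by blast
qed

text \<open>The inclusion \<open>k\<close> of the fibre has a retraction \<open>s\<close>. For
  \<open>u\<close> from \<open>A\<close> to \<open>two\<close>, the composite
  \<open>u \<cdot> s\<close> factors through \<open>q\<close>, and \<open>q\<close> is constantly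
  \<open>y\<close> on the fibre, so \<open>u\<close> is constant.\<close>

lemma minimal_decidable_fibre_terminal:
  assumes min: "is_minimal_decidable C two Z P q" and y: "y \<in> hom C \<one> P"
    and pb: "is_pullback C q y A k l" and x: "x \<in> hom C \<one> A"
    and min': "is_minimal_decidable C two A P' q'"
  shows "is_terminal C P'"
proof (rule minimal_decidable_terminal[OF min' x])
  have dec: "is_decidable C P" and q: "q \<in> hom C Z P"
    using min by (simp_all add: is_minimal_decidable_def)
  have k: "k \<in> hom C A Z" and l: "l \<in> hom C A \<one>" and "q \<cdot> k = y \<cdot> l"
    using pb by (simp_all add: is_pullback_def hom_src[OF q] hom_src[OF y])
  then have qk: "q \<cdot> k = y \<cdot> bang C A"
    using to_one by simp
  have A: "A \<in> Obj C" and Z: "Z \<in> Obj C"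
    using k hom_src_obj hom_tgt_obj by blast+
  obtain e where e: "e \<in> hom C (P \<otimes> P) two"
    and e_iff: "\<And>T r s. \<lbrakk>r \<in> hom C T P; s \<in> hom C T P\<rbrakk> \<Longrightarrow>
      e \<cdot> pair C r s = i \<cdot> bang C T \<longleftrightarrow> r = s"
    using decidable_equality_test[OF dec] by metis
  note yZ = comp_hom[OF bang_hom[OF Z] y]
  \<comment> \<open>Decidable equality on \<open>P\<close> lets \<open>w\<close> test membership in
    the fibre over \<open>y\<close>.\<close>
  define w where "w = e \<cdot> pair C q (y \<cdot> bang C Z)"
  have w: "w \<in> hom C Z two"
    unfolding w_def using comp_hom[OF pair_hom[OF q yZ] e] .
  have w_iff: "w \<cdot> t = i \<cdot> bang C T \<longleftrightarrow> q \<cdot> t = y \<cdot> bang C T" if t: "t \<in> hom C T Z" for t T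
    unfolding w_def
    using comp_assoc[OF t pair_hom[OF q yZ] e] pair_comp[OF q yZ t] point_bang_comp[OF y t]
      e_iff[OF comp_hom[OF t q] comp_hom[OF bang_hom[OF hom_src_obj[OF t]] y]] by simp
  note kx = comp_hom[OF x k]
  have "q \<cdot> (k \<cdot> x) = y \<cdot> bang C \<one>"
    using comp_assoc[OF x k q] qk point_bang_comp[OF y x] by simp
  then have "w \<cdot> (k \<cdot> x) = i"
    using w_iff[OF kx] point_bang_one[OF i_hom] by simp
  then obtain r where r: "r \<in> hom C Z Z" "w \<cdot> r = i \<cdot> bang C Z"
    and r_id: "\<And>T t. \<lbrakk>t \<in> hom C T Z; w \<cdot> t = i \<cdot> bang C T\<rbrakk> \<Longrightarrow> r \<cdot> t = t"
    using pointed_preimage_retract[OF w kx] by metis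
  have pb_univ: "\<exists>!h. h \<in> hom C T A \<and> k \<cdot> h = t \<and> l \<cdot> h = bang C T"
    if "t \<in> hom C T Z" "q \<cdot> t = y \<cdot> bang C T" for t T
    using pb that bang_hom[OF hom_src_obj[OF that(1)]] hom_src_obj[OF that(1)]
    by (simp add: is_pullback_def hom_src[OF q] hom_src[OF y])
  \<comment> \<open>Since \<open>w\<close> is true along \<open>r\<close>, the arrow
    \<open>r\<close> lands in the fibre and lifts through the pullback.\<close>
  obtain s where s: "s \<in> hom C Z A" "k \<cdot> s = r"
    using pb_univ[OF r(1)] w_iff[OF r(1)] r(2) by blast
  \<comment> \<open>The arrow \<open>r\<close> fixes whatever lies in the fibre, in particular
    \<open>k\<close>; uniqueness of the lift of \<open>k\<close> into the pullback then cancels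
    \<open>k\<close> on the left.\<close>
  have "k \<cdot> (s \<cdot> k) = k"
    using comp_assoc[OF k s(1) k] s(2) r_id[OF k] w_iff[OF k] qk by simp
  moreover have "l \<cdot> f = bang C A" if "f \<in> hom C A A" for f
    using to_one comp_hom[OF that l] by blast
  ultimately have sk: "s \<cdot> k = Ide C A"
    using pb_univ[OF k qk] comp_hom[OF k s(1)] ide_hom[OF A] comp_ide_right[OF k] by metis
  fix u assume u: "u \<in> hom C A two"
  obtain g where g: "g \<in> hom C P two" "g \<cdot> q = u \<cdot> s"
    using min comp_hom[OF s(1) u] unfolding is_minimal_decidable_def by metis
  note gy = comp_hom[OF y g(1)]
  have "u = (u \<cdot> s) \<cdot> k"
    using comp_assoc[OF k s(1) u] sk comp_ide_right[OF u] by simp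
  also have "\<dots> = (g \<cdot> y) \<cdot> bang C A"
    using g(2) comp_assoc[OF k q g(1)] qk comp_assoc[OF bang_hom[OF A] y g(1)] by simp
  finally have u_eq: "u = (g \<cdot> y) \<cdot> bang C A" .
  then have "u \<cdot> x = g \<cdot> y"
    using point_bang_comp[OF gy x] point_bang_one[OF gy] by simp
  then show "u = (u \<cdot> x) \<cdot> bang C A"
    using u_eq by simp
qed

end

section \<open>The two directions of the theorem\<close>

lemma (in homotopy_theory) p_homotopic_if_connected:
  assumes conn: "is_connected C Po A" and a: "a \<in> hom C \<one> A" and b: "b \<in> hom C \<one> A"
    and h: "h \<in> hom C (A \<otimes> X) Y" and X: "X \<in> Obj C"
    and f: "f \<in> hom C X Y" "h \<cdot> pair C (a \<cdot> bang C X) (Ide C X) = f"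
    and g: "g \<in> hom C X Y" "h \<cdot> pair C (b \<cdot> bang C X) (Ide C X) = g"
  shows "p_homotopic C p X Y f g"
proof -
  have A: "A \<in> Obj C" and trm: "is_terminal C (Po A)"
    using conn by (simp_all add: is_connected_def)
  obtain k where k: "k \<in> hom C A (Exp C Y X)" "k \<cdot> a = name_of C f" "k \<cdot> b = name_of C g"
    using slice_eq_iff_transpose[OF h A X] a b f g by metis
  let ?Z = "Exp C Y X"
  have Z: "?Z \<in> Obj C"
    using k(1) hom_tgt_obj by blast
  have pA: "p A \<in> hom C A (Po A)" and pZ: "p ?Z \<in> hom C ?Z (Po ?Z)"
    and nat: "Pa k \<cdot> p A = p ?Z \<cdot> k"
    using natural A Z k(1) unfolding is_natural_from_identity_def by blast+
  have Pk: "Pa k \<in> hom C (Po A) (Po ?Z)"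
    using endofunctor A Z k(1) unfolding is_endofunctor_def by blast
  \<comment> \<open>By naturality the class of the point \<open>k \<cdot> x\<close> depends only on
    \<open>p A \<cdot> x\<close>, and connectedness gives \<open>a\<close> and \<open>b\<close> the
    same image in \<open>Po A\<close>.\<close>
  have "p ?Z \<cdot> (k \<cdot> x) = Pa k \<cdot> (p A \<cdot> x)" if "x \<in> hom C \<one> A" for x
    using comp_assoc[OF that k(1) pZ] comp_assoc[OF that pA Pk] nat by simp
  moreover have "p A \<cdot> a = p A \<cdot> b"
    using terminal_unique[OF trm one_obj] comp_hom[OF a pA] comp_hom[OF b pA] by blast
  ultimately show ?thesis
    using a b f(1) g(1) k(2,3) unfolding p_homotopic_def by metis
qed

text \<open>Both names lie in the fibre over their common image, so they lift to points of it; the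
  untransposed inclusion of the fibre is the homotopy.\<close>

lemma (in topos) connected_homotopy_if_p_homotopic:
  assumes cop: "is_coproduct C \<one> \<one> two i j"
    and min: "\<And>X. X \<in> Obj C \<Longrightarrow> is_minimal_decidable C two X (Po X) (p X)"
    and hom: "p_homotopic C p X Y f g"
  shows "\<exists>A a b h. is_connected C Po A \<and> a \<in> hom C \<one> A \<and> b \<in> hom C \<one> A \<and>
    h \<in> hom C (A \<otimes> X) Y \<and>
    h \<cdot> pair C (a \<cdot> bang C X) (Ide C X) = f \<and> h \<cdot> pair C (b \<cdot> bang C X) (Ide C X) = g"
proof -
  interpret cartesian_closed_two C two i j
    by unfold_locales (rule cop)
  let ?Z = "Exp C Y X"
  have f: "f \<in> hom C X Y" and g: "g \<in> hom C X Y"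
    and eq: "p ?Z \<cdot> name_of C f = p ?Z \<cdot> name_of C g"
    using hom by (simp_all add: p_homotopic_def)
  have X: "X \<in> Obj C" and Y: "Y \<in> Obj C"
    using f hom_src_obj hom_tgt_obj by blast+
  note nf = name_of_hom[OF f] and ng = name_of_hom[OF g]
  note minZ = min[OF exp_obj[OF X Y]]
  have pZ: "p ?Z \<in> hom C ?Z (Po ?Z)"
    using minZ by (simp add: is_minimal_decidable_def)
  define y where "y = p ?Z \<cdot> name_of C f"
  have y: "y \<in> hom C \<one> (Po ?Z)"
    unfolding y_def using comp_hom[OF nf pZ] .
  obtain A k l where pb: "is_pullback C (p ?Z) y A k l"
    using has_pullbacks[OF pZ y] by blast
  then have A: "A \<in> Obj C" and k: "k \<in> hom C A ?Z"
    by (simp_all add: is_pullback_def hom_src[OF pZ])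
  \<comment> \<open>The point \<open>n\<close> and the identity of \<open>\<one>\<close> form the
    cone that is lifted to the pullback.\<close>
  have fibre: "\<exists>x\<in>hom C \<one> A. k \<cdot> x = n"
    if n: "n \<in> hom C \<one> ?Z" "p ?Z \<cdot> n = y" for n
    using pb n ide_hom[OF one_obj] one_obj comp_ide_right[OF y]
    unfolding is_pullback_def hom_src[OF pZ] hom_src[OF y] by metis
  obtain a where a: "a \<in> hom C \<one> A" "k \<cdot> a = name_of C f"
    using fibre[OF nf] y_def by blast
  obtain b where b: "b \<in> hom C \<one> A" "k \<cdot> b = name_of C g"
    using fibre[OF ng] y_def eq by auto
  have "is_connected C Po A"
    using minimal_decidable_fibre_terminal[OF minZ y pb a(1) min[OF A]] A
    by (simp add: is_connected_def)
  then show ?thesis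
    using a b untranspose_hom[OF k X Y] untranspose_slice_iff[OF k a(1) f]
      untranspose_slice_iff[OF k b(1) g] by blast
qed

theorem theoremC:
  fixes C :: "('o, 'a, 'x) ccc_scheme" (structure)
    and Po :: "'o \<Rightarrow> 'o" and Pa :: "'a \<Rightarrow> 'a" and p :: "'o \<Rightarrow> 'a"
  assumes "cartesian_closed C"
  shows
    "(homotopy_theory C Po Pa p \<longrightarrow>
       (\<forall>X\<in>Obj C. \<forall>Y\<in>Obj C. \<forall>f\<in>hom C X Y. \<forall>g\<in>hom C X Y.
          (\<exists>A a b h. is_connected C Po A \<and> a \<in> hom C \<one> A \<and> b \<in> hom C \<one> A \<and>
             h \<in> hom C (A \<otimes> X) Y \<and>
             h \<cdot> pair C (a \<cdot> bang C X) (Ide C X) = f \<and>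
             h \<cdot> pair C (b \<cdot> bang C X) (Ide C X) = g)
          \<longrightarrow> p_homotopic C p X Y f g))
     \<and>
     (\<forall>two i j. topos C \<and> is_coproduct C \<one> \<one> two i j \<and> NS C \<and> WDQO C two \<and>
         is_induced_by_WDQO C two Po Pa p \<longrightarrow>
       (\<forall>X\<in>Obj C. \<forall>Y\<in>Obj C. \<forall>f\<in>hom C X Y. \<forall>g\<in>hom C X Y.
          p_homotopic C p X Y f g \<longrightarrow>
          (\<exists>A a b h. is_connected C Po A \<and> a \<in> hom C \<one> A \<and> b \<in> hom C \<one> A \<and>
             h \<in> hom C (A \<otimes> X) Y \<and>
             h \<cdot> pair C (a \<cdot> bang C X) (Ide C X) = f \<and>
             h \<cdot> pair C (b \<cdot> bang C X) (Ide C X) = g)))"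
proof (intro conjI impI ballI allI)
  fix X Y f g
  assume "homotopy_theory C Po Pa p" and X: "X \<in> Obj C"
    and f: "f \<in> hom C X Y" and g: "g \<in> hom C X Y"
    and "\<exists>A a b h. is_connected C Po A \<and> a \<in> hom C \<one> A \<and> b \<in> hom C \<one> A \<and>
      h \<in> hom C (A \<otimes> X) Y \<and>
      h \<cdot> pair C (a \<cdot> bang C X) (Ide C X) = f \<and>
      h \<cdot> pair C (b \<cdot> bang C X) (Ide C X) = g"
  then show "p_homotopic C p X Y f g"
    using homotopy_theory.p_homotopic_if_connected by metis
next
  fix two i j X Y f g
  assume H: "topos C \<and> is_coproduct C \<one> \<one> two i j \<and> NS C \<and> WDQO C two \<and>
      is_induced_by_WDQO C two Po Pa p"
    and hom: "p_homotopic C p X Y f g"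
  show "\<exists>A a b h. is_connected C Po A \<and> a \<in> hom C \<one> A \<and> b \<in> hom C \<one> A \<and>
      h \<in> hom C (A \<otimes> X) Y \<and>
      h \<cdot> pair C (a \<cdot> bang C X) (Ide C X) = f \<and>
      h \<cdot> pair C (b \<cdot> bang C X) (Ide C X) = g"
    using H unfolding is_induced_by_WDQO_def
    by (intro topos.connected_homotopy_if_p_homotopic[OF _ _ _ hom]) blast+
qed

end
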